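(* Let $G$ and $H$ be nontrivial graphs, let $k=\omega(H)$, and let $n\ge 2$ be an integer. If $\iota(H,K_n)=0$, then $$\iota(G\circ H,K_n)=\iota(G,K_r),\qquad\text{where } r=\left\lceil\frac{n}{k}\right\rceil.$$
   Context: All graphs are finite, simple and undirected; a graph is nontrivial if it has at least two vertices. The lexicographic product $G\circ H$ has vertex set $V(G)\times V(H)$, and distinct vertices $(g,h)$, $(g',h')$ are adjacent if and only if $gg'\in E(G)$, or $g=g'$ and $hh'\in E(H)$. $\omega(H)$ is the clique number of $H$ (the order of a largest complete subgraph) and $K_n$ is the complete graph on $n$ vertices. For a graph $F$, a set $S\subseteq V(G)$ is an $F$-isolating set of $G$ if the subgraph induced by $V(G)-N_G[S]$ contains no subgraph isomorphic to $F$, where $N_G[S]$ is the closed neighborhood of $S$; $\iota(G,F)$ is the minimum cardinality of an $F$-isolating set of $G$ (so it is $0$ if $G$ contains no subgraph isomorphic to $F$). *)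

theory Defs
  imports Complex_Main "Graph_Theory.Graph_Theory"
begin

text \<open>
  A finite simple undirected graph is a \<^locale>\<open>pair_graph\<close>: a finite vertex set with a finite,
  symmetric, irreflexive set of arcs, so that an edge \<open>uv\<close> is the pair of arcs \<open>(u,v)\<close>, \<open>(v,u)\<close>.
\<close>

definition lexicographic_product ::
    "'a pair_pre_digraph \<Rightarrow> 'b pair_pre_digraph \<Rightarrow> ('a \<times> 'b) pair_pre_digraph" where
  "lexicographic_product G H =
     \<lparr> pverts = pverts G \<times> pverts H,
       parcs = {((g, h), (g', h')) | g h g' h'.
          g \<in> pverts G \<and> h \<in> pverts H \<and> g' \<in> pverts G \<and> h' \<in> pverts H \<and>
          ((g, g') \<in> parcs G \<or> g = g' \<and> (h, h') \<in> parcs H)} \<rparr>"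

definition complete_graph :: "nat \<Rightarrow> nat pair_pre_digraph" where
  "complete_graph n = \<lparr> pverts = {..<n}, parcs = {(i, j). i < n \<and> j < n \<and> i \<noteq> j} \<rparr>"

text \<open>
  The subgraphs \<open>C\<close> below may have asymmetric arc sets; \<^const>\<open>complete_digraph\<close> requires
  \<^term>\<open>graph C\<close>, which rules these out.
\<close>
definition clique_number :: "'a pair_pre_digraph \<Rightarrow> nat" where
  "clique_number G = Max {m. \<exists>C. subgraph C (with_proj G) \<and> complete_digraph m C}"

definition contains_copy_of :: "('a, 'a \<times> 'a) pre_digraph \<Rightarrow> 'f pair_pre_digraph \<Rightarrow> bool" where
  "contains_copy_of G F \<longleftrightarrow> (\<exists>G'. subgraph G' G \<and> digraph_iso G' (with_proj F))"

definition closed_neighborhood :: "'a pair_pre_digraph \<Rightarrow> 'a set \<Rightarrow> 'a set" where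
  "closed_neighborhood G S = S \<union> {v. \<exists>u \<in> S. (u, v) \<in> parcs G}"

definition isolating_set :: "'a pair_pre_digraph \<Rightarrow> 'f pair_pre_digraph \<Rightarrow> 'a set \<Rightarrow> bool" where
  "isolating_set G F S \<longleftrightarrow> S \<subseteq> pverts G \<and>
     \<not> contains_copy_of (with_proj G \<restriction> (pverts G - closed_neighborhood G S)) F"

text \<open>
  For finite \<open>G\<close> and \<open>F\<close> with at least one vertex the minimum exists, since the whole vertex set
  is isolating; for the empty \<open>F\<close> there is no isolating set.
\<close>
definition isolation_number :: "'a pair_pre_digraph \<Rightarrow> 'f pair_pre_digraph \<Rightarrow> nat" where
  "isolation_number G F = (LEAST m. \<exists>S. isolating_set G F S \<and> card S = m)"

lemma complete_digraph_complete_graph: "complete_digraph n (with_proj (complete_graph n))"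
  by (auto simp: complete_digraph_pair_def complete_graph_def)

lemma pair_graph_lexicographic_product:
  assumes "pair_graph G" "pair_graph H"
  shows "pair_graph (lexicographic_product G H)"
proof -
  interpret G: pair_graph G by fact
  interpret H: pair_graph H by fact
  let ?P = "lexicographic_product G H"
  have V: "finite (pverts ?P)"
    using G.pair_finite_verts H.pair_finite_verts by (simp add: lexicographic_product_def)
  have "parcs ?P \<subseteq> pverts ?P \<times> pverts ?P"
    by (auto simp: lexicographic_product_def)
  then have A: "finite (parcs ?P)"
    using V by (meson finite_SigmaI finite_subset)
  have symG: "(v, u) \<in> parcs G" if "(u, v) \<in> parcs G" for u v
    using G.pair_sym_arcs that by (auto simp: symmetric_def sym_def)
  have symH: "(v, u) \<in> parcs H" if "(u, v) \<in> parcs H" for u v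
    using H.pair_sym_arcs that by (auto simp: symmetric_def sym_def)
  show ?thesis
  proof unfold_locales
    show "symmetric (with_proj ?P)"
      by (auto simp: symmetric_def sym_def lexicographic_product_def dest: symG symH)
    show "fst e \<noteq> snd e" if "e \<in> parcs ?P" for e
      using that G.pair_no_loops H.pair_no_loops
      by (fastforce simp: lexicographic_product_def)
  qed (use V A in \<open>auto simp: lexicographic_product_def\<close>)
qed

lemma isolating_set_pverts:
  assumes "pverts F \<noteq> {}"
  shows "isolating_set G F (pverts G)"
  using assms
  by (auto simp: isolating_set_def contains_copy_of_def closed_neighborhood_def subgraph_def
      digraph_iso_def dest!: arg_cong[where f = verts])

end

theory Submission
  imports Defs
begin

text \<open>
  For complete \<open>F\<close>, being \<open>F\<close>-isolating is a statement about cliques: the closed neighbourhood of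
  the set meets every clique with \<open>n\<close> vertices. So everything rests on how cliques of \<open>G \<circ> H\<close> look.
  A clique projects onto a clique of \<open>G\<close>, and its fibres are cliques of \<open>H\<close>, hence have at most
  \<open>k = \<omega>(H)\<close> vertices; conversely the product of a clique of \<open>G\<close> and a clique of \<open>H\<close> is a clique.
  Thus a set of vertices of \<open>G\<close> carries a clique of size \<open>n\<close> in \<open>G \<circ> H\<close> exactly when it contains a
  clique of at least \<open>\<lceil>n / k\<rceil>\<close> vertices.

  An isolating set of \<open>G \<circ> H\<close> projects to one of \<open>G\<close>, because what it dominates lies over what its
  projection dominates (\<open>isolating_set_projection\<close>). An isolating set \<open>S\<close> of \<open>G\<close> lifts to the copy
  \<open>S \<times> {h}\<close>, for any vertex \<open>h\<close> of \<open>H\<close>. The vertices left over by this copy may lie over \<open>S\<close> itself,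
  but the neighbours of a vertex of \<open>S\<close> are removed with their entire fibres, so a clique over
  \<open>s \<in> S\<close> stays inside the fibre of \<open>s\<close>, which is a copy of \<open>H\<close>. The assumption that \<open>H\<close> has
  isolation number zero says that \<open>H\<close> contains no complete graph on \<open>n\<close> vertices, so this clique is
  too small (\<open>isolating_set_lift\<close>). Neither passage increases the cardinality.
\<close>

section \<open>Cliques as vertex sets\<close>

definition clique :: "'a pair_pre_digraph \<Rightarrow> 'a set \<Rightarrow> bool" where
  "clique G C \<longleftrightarrow> finite C \<and> C \<subseteq> pverts G \<and> (\<forall>u \<in> C. \<forall>v \<in> C. u \<noteq> v \<longrightarrow> (u, v) \<in> parcs G)"

lemma cliqueD:
  assumes "clique G C"
  shows "finite C" "C \<subseteq> pverts G" "u \<in> C \<Longrightarrow> v \<in> C \<Longrightarrow> u \<noteq> v \<Longrightarrow> (u, v) \<in> parcs G"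
  using assms by (auto simp: clique_def)

lemma clique_subset: "clique G C \<Longrightarrow> D \<subseteq> C \<Longrightarrow> clique G D"
  by (auto simp: clique_def intro: finite_subset)

lemma clique_shrink:
  assumes "clique G C" "n \<le> card C"
  obtains D where "D \<subseteq> C" "clique G D" "card D = n"
  using assms by (metis clique_subset obtain_subset_with_card_n)

text \<open>
  An isomorphism onto \<^term>\<open>complete_graph n\<close> transports each arc through its tail and head, so that
  the arcs of any isomorphic copy are forced to be all pairs of distinct vertices; in the other
  direction an enumeration of the clique induces the isomorphism.
\<close>
lemma contains_complete_graph_iff_clique:
  assumes "pair_wf_digraph G" "W \<subseteq> pverts G"
  shows "contains_copy_of (with_proj G \<restriction> W) (complete_graph n) \<longleftrightarrow>
    (\<exists>C \<subseteq> W. clique G C \<and> card C = n)"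
proof
  assume "contains_copy_of (with_proj G \<restriction> W) (complete_graph n)"
  then obtain C f where sub: "subgraph C (with_proj G \<restriction> W)"
    and iso: "pre_digraph.digraph_isomorphism C f"
    and eq: "with_proj (complete_graph n) = app_iso f C"
    by (auto simp: contains_copy_of_def digraph_iso_def)
  have th: "tail C = fst" "head C = snd"
    using sub by (auto simp: subgraph_def compatible_def)
  have sv: "verts C \<subseteq> W" and sa: "arcs C \<subseteq> parcs G"
    using sub by (auto simp: subgraph_def)
  have wf: "wf_digraph C" using sub by (simp add: subgraph_def)
  have inj: "inj_on (iso_verts f) (verts C)"
    using iso by (simp add: pre_digraph.digraph_isomorphism_def)
  have V: "iso_verts f ` verts C = {..<n}"
    using arg_cong[OF eq, of verts] by (simp add: complete_graph_def)
  have A: "iso_arcs f ` arcs C = {(i, j). i < n \<and> j < n \<and> i \<noteq> j}"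
    using arg_cong[OF eq, of arcs] by (simp add: complete_graph_def)
  have TH: "iso_tail f = fst" "iso_head f = snd"
    using arg_cong[OF eq, of tail] arg_cong[OF eq, of head] by simp_all
  have "(u, v) \<in> parcs G" if uv: "u \<in> verts C" "v \<in> verts C" "u \<noteq> v" for u v
  proof -
    have "(iso_verts f u, iso_verts f v) \<in> iso_arcs f ` arcs C"
      unfolding A using uv V inj by (auto dest: inj_onD)
    then obtain a where a: "a \<in> arcs C" "iso_arcs f a = (iso_verts f u, iso_verts f v)"
      by auto
    have "iso_verts f (fst a) = iso_verts f u" "iso_verts f (snd a) = iso_verts f v"
      using iso a by (auto simp: pre_digraph.digraph_isomorphism_def th TH)
    moreover have "fst a \<in> verts C" "snd a \<in> verts C"
      using wf_digraph.tail_in_verts[OF wf a(1)] wf_digraph.head_in_verts[OF wf a(1)]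
      by (simp_all add: th)
    ultimately have "fst a = u" "snd a = v" using inj uv by (simp_all add: inj_on_eq_iff)
    then have "a = (u, v)" by auto
    then show ?thesis using a sa by auto
  qed
  moreover have "finite (verts C)" "card (verts C) = n"
    using V inj finite_imageD[of "iso_verts f" "verts C"] card_image[OF inj] by simp_all
  ultimately have "clique G (verts C)" "card (verts C) = n"
    using sv assms(2) by (simp_all add: clique_def)
  then show "\<exists>C \<subseteq> W. clique G C \<and> card C = n" using sv by blast
next
  assume "\<exists>C \<subseteq> W. clique G C \<and> card C = n"
  then obtain C where C: "C \<subseteq> W" "clique G C" "card C = n" by auto
  interpret pair_wf_digraph G by fact
  obtain f where f: "bij_betw f C {..<n}"
    using ex_bij_betw_finite_nat[OF cliqueD(1)[OF C(2)]] C(3) by (auto simp: atLeast0LessThan)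
  let ?K = "with_proj \<lparr>pverts = C, parcs = {(u, v). u \<in> C \<and> v \<in> C \<and> u \<noteq> v}\<rparr>"
  let ?f = "\<lparr>iso_verts = f, iso_arcs = map_prod f f, iso_head = snd, iso_tail = fst\<rparr>"
  have inj: "inj_on f C" and im: "f ` C = {..<n}" using f by (auto simp: bij_betw_def)
  have wf: "wf_digraph ?K" by unfold_locales auto
  have "subgraph ?K (with_proj G \<restriction> W)"
    using C wf assms by (auto simp: subgraph_def clique_def compatible_def)
  moreover have "pre_digraph.digraph_isomorphism ?K ?f"
    using inj wf by (auto simp: pre_digraph.digraph_isomorphism_def inj_on_def)
  moreover have "map_prod f f ` {(u, v). u \<in> C \<and> v \<in> C \<and> u \<noteq> v} = {(i, j). i < n \<and> j < n \<and> i \<noteq> j}"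
  proof (intro equalityI subsetI)
    fix p assume "p \<in> {(i, j). i < n \<and> j < n \<and> i \<noteq> j}"
    then obtain i j where p: "p = (i, j)" "i \<in> f ` C" "j \<in> f ` C" "i \<noteq> j"
      using im by auto
    then obtain u v where "u \<in> C" "v \<in> C" "u \<noteq> v" "p = (f u, f v)" by blast
    then show "p \<in> map_prod f f ` {(u, v). u \<in> C \<and> v \<in> C \<and> u \<noteq> v}"
      by (auto simp: image_iff)
  qed (use inj im in \<open>auto dest: inj_onD\<close>)
  then have "with_proj (complete_graph n) = app_iso ?f ?K"
    using im by (simp add: app_iso_def with_proj_def complete_graph_def)
  ultimately show "contains_copy_of (with_proj G \<restriction> W) (complete_graph n)"
    unfolding contains_copy_of_def digraph_iso_def by blast
qed

text \<open>
  The subgraphs that define the clique number have arcs of the same pair type and, by compatibility,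
  the projections as tail and head; hence they are determined by their vertex and arc sets.
\<close>
lemma complete_subgraph_iff_clique:
  assumes "pair_wf_digraph G"
  shows "(\<exists>C. subgraph C (with_proj G) \<and> complete_digraph m C) \<longleftrightarrow> (\<exists>C. clique G C \<and> card C = m)"
proof
  assume "\<exists>C. subgraph C (with_proj G) \<and> complete_digraph m C"
  then obtain C where C: "subgraph C (with_proj G)" "complete_digraph m C" by auto
  interpret C: graph C using C by (simp add: complete_digraph_def)
  have "tail C = fst" "head C = snd" "arcs C \<subseteq> parcs G" "verts C \<subseteq> pverts G"
    using C by (auto simp: subgraph_def compatible_def)
  then have "arcs_ends C \<subseteq> parcs G" by (auto simp: arcs_ends_conv)
  then have "clique G (verts C)" using C \<open>verts C \<subseteq> pverts G\<close>
    by (auto simp: clique_def complete_digraph_def)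
  then show "\<exists>C. clique G C \<and> card C = m" using C by (auto simp: complete_digraph_def)
next
  assume "\<exists>C. clique G C \<and> card C = m"
  then obtain C where C: "clique G C" "card C = m" by auto
  let ?K = "with_proj \<lparr>pverts = C, parcs = {(u, v). u \<in> C \<and> v \<in> C \<and> u \<noteq> v}\<rparr>"
  have "wf_digraph ?K" by unfold_locales auto
  then have "subgraph ?K (with_proj G)" "complete_digraph m ?K"
    using C assms unfolding complete_digraph_pair_def
    by (auto simp: subgraph_def clique_def wf_digraph_wp_iff)
  then show "\<exists>C. subgraph C (with_proj G) \<and> complete_digraph m C" by blast
qed

lemma clique_number_bound_and_attained:
  assumes "pair_fin_digraph G"
  shows "clique G C \<Longrightarrow> card C \<le> clique_number G"
    and "\<exists>C. clique G C \<and> card C = clique_number G"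
proof -
  interpret pair_fin_digraph G by fact
  let ?M = "{m. \<exists>C. clique G C \<and> card C = m}"
  have eq: "clique_number G = Max ?M"
    using complete_subgraph_iff_clique[OF pair_wf_digraph_axioms] by (simp add: clique_number_def)
  have "?M \<subseteq> card ` Pow (pverts G)" by (auto simp: clique_def)
  then have fin: "finite ?M" using pair_finite_verts by (meson finite_Pow_iff finite_imageI finite_subset)
  have "clique G {}" by (simp add: clique_def)
  then have "?M \<noteq> {}" by auto
  then show "\<exists>C. clique G C \<and> card C = clique_number G" using Max_in[OF fin] eq by auto
  show "card C \<le> clique_number G" if "clique G C" using Max_ge[OF fin] that eq by auto
qed

section \<open>Isolating cliques\<close>

lemma isolating_set_complete_graph_iff:
  assumes "pair_wf_digraph G"
  shows "isolating_set G (complete_graph n) S \<longleftrightarrow> S \<subseteq> pverts G \<and>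
    (\<forall>C. clique G C \<longrightarrow> card C = n \<longrightarrow> C \<inter> closed_neighborhood G S \<noteq> {})"
proof -
  have "contains_copy_of (with_proj G \<restriction> (pverts G - closed_neighborhood G S)) (complete_graph n)
    \<longleftrightarrow> (\<exists>C. clique G C \<and> card C = n \<and> C \<inter> closed_neighborhood G S = {})"
    by (subst contains_complete_graph_iff_clique) (use assms in \<open>auto dest: cliqueD(2)\<close>)
  then show ?thesis by (auto simp: isolating_set_def)
qed

lemma isolation_number_le: "isolating_set G F S \<Longrightarrow> isolation_number G F \<le> card S"
  unfolding isolation_number_def by (rule Least_le) auto

lemma isolation_number_attained:
  assumes "pverts F \<noteq> {}"
  obtains S where "isolating_set G F S" "card S = isolation_number G F"
proof -
  have "\<exists>S. isolating_set G F S \<and> card S = isolation_number G F"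
    unfolding isolation_number_def by (rule LeastI_ex) (use isolating_set_pverts[OF assms] in auto)
  then show thesis using that by auto
qed

lemma pverts_complete_graph_nonempty: "0 < n \<Longrightarrow> pverts (complete_graph n) \<noteq> {}"
  by (force simp: complete_graph_def)

text \<open>
  In a finite graph only the empty set has cardinality \<open>0\<close> among the isolating sets, and it
  dominates nothing, so no clique of size \<open>n\<close> can be present.
\<close>
lemma isolation_number_eq_0D:
  assumes "pair_fin_digraph G" "isolation_number G (complete_graph n) = 0" "0 < n"
  shows "clique_number G < n"
proof (rule ccontr)
  assume "\<not> clique_number G < n"
  interpret pair_fin_digraph G by fact
  obtain C where C: "clique G C" "card C = n"
    using clique_number_bound_and_attained(2)[OF assms(1)] \<open>\<not> clique_number G < n\<close>
    by (metis clique_shrink not_less)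
  have "pverts (complete_graph n) \<noteq> {}" using assms(3) by (rule pverts_complete_graph_nonempty)
  then obtain S where S: "isolating_set G (complete_graph n) S" "card S = 0"
    using isolation_number_attained assms(2) by metis
  then have "S = {}"
    using pair_finite_verts by (metis card_0_eq finite_subset isolating_set_def)
  then show False
    using S(1) C by (auto simp: isolating_set_complete_graph_iff[OF pair_wf_digraph_axioms] closed_neighborhood_def)
qed

section \<open>Cliques of a lexicographic product\<close>

lemma clique_lexicographic_product_Times:
  assumes "clique G C" "clique H K"
  shows "clique (lexicographic_product G H) (C \<times> K)"
  using assms by (auto simp: clique_def lexicographic_product_def)

lemma clique_lexicographic_product_fst:
  assumes "clique (lexicographic_product G H) D"
  shows "clique G (fst ` D)"
  using assms by (fastforce simp: clique_def lexicographic_product_def)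

text \<open>
  Two vertices over the same \<open>g\<close> can only be joined by an edge of \<open>H\<close>, as \<open>G\<close> has no loop at \<open>g\<close>.
\<close>
lemma clique_lexicographic_product_fibre:
  assumes "pair_loopfree_digraph G" "clique (lexicographic_product G H) D"
  shows "clique H {h. (g, h) \<in> D}"
proof -
  have "{h. (g, h) \<in> D} \<subseteq> snd ` D" by force
  then have "finite {h. (g, h) \<in> D}" using cliqueD(1)[OF assms(2)] by (meson finite_imageI finite_subset)
  moreover have "(g, g) \<notin> parcs G"
    using pair_loopfree_digraph.pair_no_loops[OF assms(1), of "(g, g)"] by auto
  ultimately show ?thesis using assms(2)
    by (fastforce simp: clique_def lexicographic_product_def)
qed

text \<open>
  Counting \<open>D\<close> fibre by fibre: each of the \<open>card (fst ` D)\<close> fibres is a clique of \<open>H\<close>.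
\<close>
lemma card_clique_lexicographic_product_le:
  assumes "pair_loopfree_digraph G" "pair_fin_digraph H" "clique (lexicographic_product G H) D"
  shows "card D \<le> card (fst ` D) * clique_number H"
proof -
  have "D = (SIGMA g:fst ` D. {h. (g, h) \<in> D})" by force
  then have "card D = card (SIGMA g:fst ` D. {h. (g, h) \<in> D})" by (rule arg_cong)
  also have "\<dots> = (\<Sum>g \<in> fst ` D. card {h. (g, h) \<in> D})"
    using cliqueD(1)[OF assms(3)] cliqueD(1)[OF clique_lexicographic_product_fibre[OF assms(1,3)]]
    by (intro card_SigmaI) auto
  also have "\<dots> \<le> card (fst ` D) * clique_number H"
    using clique_number_bound_and_attained(1)[OF assms(2) clique_lexicographic_product_fibre[OF assms(1,3)]]
    by (intro sum_bounded_above[THEN order_trans]) auto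
  finally show ?thesis .
qed

section \<open>Transferring isolating sets\<close>

text \<open>
  Suppose that a clique \<open>C\<close> of size \<open>r\<close> avoided what the projection of \<open>T\<close> dominates. Multiplied
  by a maximum clique of \<open>H\<close> it would give a clique with at least \<open>n\<close> vertices of the product.
  None of them is dominated by \<open>T\<close>, because adjacent vertices of the product have equal or adjacent
  first coordinates.
\<close>
lemma isolating_set_projection:
  assumes "pair_wf_digraph G" "pair_fin_digraph H" "pair_wf_digraph (lexicographic_product G H)"
    and "n \<le> r * clique_number H"
    and T: "isolating_set (lexicographic_product G H) (complete_graph n) T"
  shows "isolating_set G (complete_graph r) (fst ` T)"
  unfolding isolating_set_complete_graph_iff[OF assms(1)]
proof (intro conjI allI impI)
  note iso = T[unfolded isolating_set_complete_graph_iff[OF assms(3)]]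
  show "fst ` T \<subseteq> pverts G" using iso by (auto simp: lexicographic_product_def)
  fix C assume C: "clique G C" "card C = r"
  obtain K where K: "clique H K" "card K = clique_number H"
    using clique_number_bound_and_attained(2)[OF assms(2)] by auto
  have "clique (lexicographic_product G H) (C \<times> K)" "n \<le> card (C \<times> K)"
    using C K assms(4) by (auto simp: clique_lexicographic_product_Times card_cartesian_product)
  then obtain D where D: "D \<subseteq> C \<times> K" "clique (lexicographic_product G H) D" "card D = n"
    by (rule clique_shrink)
  then have "D \<inter> closed_neighborhood (lexicographic_product G H) T \<noteq> {}" using iso by blast
  moreover have "fst ` closed_neighborhood (lexicographic_product G H) T
      \<subseteq> closed_neighborhood G (fst ` T)"
    by (force simp: closed_neighborhood_def lexicographic_product_def)
  ultimately show "C \<inter> closed_neighborhood G (fst ` T) \<noteq> {}"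
    using D(1) by fastforce
qed

text \<open>
  The hypothesis on \<open>r\<close> makes the projection of a clique of size \<open>n\<close> have at least \<open>r\<close>
  vertices, so \<open>S\<close> dominates some \<open>g\<close> in it. If \<open>g\<close> is a neighbour of \<open>S\<close>, its whole fibre is
  dominated by \<open>S \<times> {h}\<close>. If \<open>g \<in> S\<close>, some vertices over \<open>g\<close> may survive, but a
  clique over the single vertex \<open>g\<close> has at most \<^term>\<open>clique_number H\<close>, hence fewer than \<open>n\<close> vertices.
\<close>
lemma isolating_set_lift:
  assumes "pair_digraph G" "pair_fin_digraph H" "pair_wf_digraph (lexicographic_product G H)"
    and "clique_number H < n" and r: "\<And>m. n \<le> m * clique_number H \<Longrightarrow> r \<le> m"
    and h: "h \<in> pverts H" and S: "isolating_set G (complete_graph r) S"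
  shows "isolating_set (lexicographic_product G H) (complete_graph n) (S \<times> {h})"
  unfolding isolating_set_complete_graph_iff[OF assms(3)]
proof (intro conjI allI impI notI)
  interpret G: pair_digraph G by fact
  note iso = S[unfolded isolating_set_complete_graph_iff[OF G.pair_wf_digraph_axioms]]
  let ?P = "lexicographic_product G H"
  show "S \<times> {h} \<subseteq> pverts ?P" using iso h by (auto simp: lexicographic_product_def)
  fix D assume D: "clique ?P D" "card D = n" "D \<inter> closed_neighborhood ?P (S \<times> {h}) = {}"
  have bound: "n \<le> card (fst ` D) * clique_number H"
    using card_clique_lexicographic_product_le[OF G.pair_loopfree_digraph_axioms assms(2) D(1)] D(2) by simp
  then have "r \<le> card (fst ` D)" by (rule r)
  then obtain C where C: "C \<subseteq> fst ` D" "clique G C" "card C = r"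
    by (rule clique_shrink[OF clique_lexicographic_product_fst[OF D(1)]])
  then obtain g where g: "g \<in> C" "g \<in> closed_neighborhood G S" using iso by blast
  have no_nbr: "(s, g') \<notin> parcs G" if sg: "s \<in> S" "g' \<in> fst ` D" for s g'
  proof
    assume "(s, g') \<in> parcs G"
    obtain h' where h': "(g', h') \<in> D" using sg(2) by fastforce
    then have "(g', h') \<in> pverts ?P" using cliqueD(2)[OF D(1)] by blast
    then have "((s, h), (g', h')) \<in> parcs ?P"
      using \<open>(s, g') \<in> parcs G\<close> h iso sg by (auto simp: lexicographic_product_def)
    then show False using D(3) h' sg by (auto simp: closed_neighborhood_def)
  qed
  then have "g \<in> S" using g C(1) unfolding closed_neighborhood_def by blast
  have "g \<in> fst ` D" using g C(1) by blast
  \<comment> \<open>A second vertex of the projection would be a neighbour of \<open>g\<close>, and everything over it dominated.\<close>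
  have "g' = g" if "g' \<in> fst ` D" for g'
    using cliqueD(3)[OF clique_lexicographic_product_fst[OF D(1)] \<open>g \<in> fst ` D\<close> that]
      no_nbr[OF \<open>g \<in> S\<close> that] by metis
  then have "fst ` D \<subseteq> {g}" by (simp add: subset_iff)
  then have "card (fst ` D) \<le> 1" using card_mono[of "{g}" "fst ` D"] by simp
  then have "card (fst ` D) * clique_number H \<le> clique_number H"
    by (metis mult_le_mono1 mult_1)
  then show False using bound assms(4) by linarith
qed

section \<open>The isolation number of the product\<close>

lemma nat_ceiling_divide_le_iff:
  assumes "0 < k"
  shows "nat \<lceil>real n / real k\<rceil> \<le> m \<longleftrightarrow> n \<le> m * k"
proof -
  have "nat \<lceil>real n / real k\<rceil> \<le> m \<longleftrightarrow> real n / real k \<le> real m"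
    by (simp add: nat_le_iff ceiling_le_iff)
  also have "\<dots> \<longleftrightarrow> real n \<le> real (m * k)" using assms by (simp add: pos_divide_le_eq)
  finally show ?thesis unfolding of_nat_le_iff .
qed

theorem proposition5p2:
  fixes G :: "'a pair_pre_digraph" and H :: "'b pair_pre_digraph" and n k r :: nat
  assumes "pair_graph G" and "pair_graph H"
    and "card (pverts G) \<ge> 2" and "card (pverts H) \<ge> 2"
    and "k = clique_number H"
    and "n \<ge> 2"
    and "isolation_number H (complete_graph n) = 0"
    and "r = nat \<lceil>real n / real k\<rceil>"
  shows "isolation_number (lexicographic_product G H) (complete_graph n)
       = isolation_number G (complete_graph r)"
proof -
  let ?P = "lexicographic_product G H"
  interpret G: pair_graph G by fact
  interpret H: pair_graph H by fact
  interpret P: pair_graph ?P by (rule pair_graph_lexicographic_product) fact+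
  obtain h where h: "h \<in> pverts H" using assms(4) by fastforce
  have "clique H {h}" using h by (simp add: clique_def)
  then have "0 < k"
    using clique_number_bound_and_attained(1)[OF H.pair_fin_digraph_axioms] assms(5) by fastforce
  have r_iff: "r \<le> m \<longleftrightarrow> n \<le> m * clique_number H" for m
    using nat_ceiling_divide_le_iff[OF \<open>0 < k\<close>] assms(5,8) by simp
  have "clique_number H < n"
    using isolation_number_eq_0D[OF H.pair_fin_digraph_axioms assms(7)] assms(6) by simp
  show ?thesis
  proof (rule antisym)
    \<comment> \<open>Since \<open>r > 0\<close>, the minimum over the isolating sets of \<open>G\<close> is attained.\<close>
    have "0 < r" using r_iff[of 0] assms(6) by simp
    then have "pverts (complete_graph r) \<noteq> {}" by (rule pverts_complete_graph_nonempty)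
    then obtain S where S: "isolating_set G (complete_graph r) S"
        "card S = isolation_number G (complete_graph r)"
      by (rule isolation_number_attained)
    have "isolating_set ?P (complete_graph n) (S \<times> {h})"
      using isolating_set_lift[OF G.pair_digraph_axioms H.pair_fin_digraph_axioms P.pair_wf_digraph_axioms
          \<open>clique_number H < n\<close> _ h S(1)] r_iff by blast
    then show "isolation_number ?P (complete_graph n) \<le> isolation_number G (complete_graph r)"
      using isolation_number_le S(2) by (fastforce simp: card_cartesian_product)
  next
    have "pverts (complete_graph n) \<noteq> {}" using assms(6) by (simp add: pverts_complete_graph_nonempty)
    then obtain T where T: "isolating_set ?P (complete_graph n) T"
        "card T = isolation_number ?P (complete_graph n)"
      by (rule isolation_number_attained)
    have "isolating_set G (complete_graph r) (fst ` T)"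
      using isolating_set_projection[OF G.pair_wf_digraph_axioms H.pair_fin_digraph_axioms P.pair_wf_digraph_axioms
          _ T(1)] r_iff by blast
    then have "isolation_number G (complete_graph r) \<le> card (fst ` T)" by (rule isolation_number_le)
    also have "finite T"
      using T(1) P.pair_finite_verts finite_subset unfolding isolating_set_def by blast
    then have "card (fst ` T) \<le> card T" by (rule card_image_le)
    finally show "isolation_number G (complete_graph r) \<le> isolation_number ?P (complete_graph n)"
      using T(2) by simp
  qed
qed

end
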